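(* Let $\mathcal{A}=(Q,A,\cdot,\circ)$ be a transducer. Then the following are equivalent: (i) $\mathcal{S}(\mathcal{A})$ is finite; (ii) there is an integer $n$ such that $\|(\partial\mathcal{A})^{k}\|\le n$ for all $k\ge 1$; (iii) $\mathcal{S}(\partial\mathcal{A})$ is finite; (iv) there is an integer $m$ such that $\|\mathcal{A}^{k}\|\le m$ for all $k\ge 1$.
   Context: A transducer $\mathcal{A}=(Q,A,\cdot,\circ)$ consists of a finite set $Q$ of states, a finite alphabet $A$, a transition map $(q,a)\mapsto q\cdot a\in Q$ and an output map $(q,a)\mapsto q\circ a\in A$; it is viewed as a labelled digraph with vertex set $Q$ and an edge $q\xrightarrow{a|b}p$ iff $q\cdot a=p$, $q\circ a=b$. Each state acts on $A^{*}$ by $q\circ(a_1\ldots a_n)=(q\circ a_1)((q\cdot a_1)\circ(a_2\ldots a_n))$, and $\mathcal{S}(\mathcal{A})$ is the semigroup generated by these maps. The dual $\partial\mathcal{A}$ has states $A$, alphabet $Q$ and an edge $a\xrightarrow{p|q}b$ for each edge $p\xrightarrow{a|b}q$ of $\mathcal{A}$. The product $\mathcal{A}\mathcal{B}$ of transducers over the same alphabet has as states the pairs of states, with an edge $(q,q')\xrightarrow{a|b}(p,p')$ whenever $q\xrightarrow{a|c}p$ in $\mathcal{A}$ and $q'\xrightarrow{c|b}p'$ in $\mathcal{B}$; $\mathcal{A}^{1}=\mathcal{A}$ and $\mathcal{A}^{k}=\mathcal{A}^{k-1}\mathcal{A}$. For a transducer $\Gamma$ and a vertex $v$, $\|(\Gamma,v)\|$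 is the number of vertices of the component $(\Gamma,v)$, understood as the graph of the orbit of $v$, i.e. the set of vertices reachable from $v$ by directed paths (including $v$); $\|\Gamma\|=\max_v\|(\Gamma,v)\|$. *)

theory Defs
  imports "HOL-Library.FuncSet"
begin

record ('q, 'a) transducer =
  states :: "'q set"
  alphabet :: "'a set"
  next_state :: "'q \<Rightarrow> 'a \<Rightarrow> 'q"
  out_letter :: "'q \<Rightarrow> 'a \<Rightarrow> 'a"

definition wf_transducer :: "('q, 'a) transducer \<Rightarrow> bool" where
  "wf_transducer T \<longleftrightarrow> finite (states T) \<and> finite (alphabet T) \<and>
     (\<forall>q\<in>states T. \<forall>a\<in>alphabet T. next_state T q a \<in> states T \<and> out_letter T q a \<in> alphabet T)"

text \<open>\<open>edge T q a b p\<close> is the labelled edge from \<open>q\<close> to \<open>p\<close> with input \<open>a\<close> and output \<open>b\<close>.\<close>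

definition edge :: "('q, 'a) transducer \<Rightarrow> 'q \<Rightarrow> 'a \<Rightarrow> 'a \<Rightarrow> 'q \<Rightarrow> bool" where
  "edge T q a b p \<longleftrightarrow>
     q \<in> states T \<and> a \<in> alphabet T \<and> next_state T q a = p \<and> out_letter T q a = b"

fun act :: "('q, 'a) transducer \<Rightarrow> 'q \<Rightarrow> 'a list \<Rightarrow> 'a list" where
  "act T q [] = []"
| "act T q (a # w) = out_letter T q a # act T (next_state T q a) w"

text \<open>Only the values on words over the alphabet matter, so the maps are taken to be
  extensional: two states acting equally on these words give the same element.\<close>

definition state_map :: "('q, 'a) transducer \<Rightarrow> 'q \<Rightarrow> 'a list \<Rightarrow> 'a list" where
  "state_map T q = restrict (act T q) (lists (alphabet T))"

inductive_set transducer_semigroup :: "('q, 'a) transducer \<Rightarrow> ('a list \<Rightarrow> 'a list) set"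
  for T where
  generator: "q \<in> states T \<Longrightarrow> state_map T q \<in> transducer_semigroup T"
| product: "f \<in> transducer_semigroup T \<Longrightarrow> g \<in> transducer_semigroup T \<Longrightarrow>
    compose (lists (alphabet T)) f g \<in> transducer_semigroup T"

definition dual :: "('q, 'a) transducer \<Rightarrow> ('a, 'q) transducer" where
  "dual T = \<lparr>states = alphabet T, alphabet = states T,
     next_state = (\<lambda>a q. out_letter T q a), out_letter = (\<lambda>a q. next_state T q a)\<rparr>"

lemma edge_dual:
  "edge (dual T) a p q b \<longleftrightarrow> edge T p a b q"
  by (auto simp: edge_def dual_def)

text \<open>Meant for transducers with the same alphabet; the output of the first factor is the
  input of the second.\<close>

definition tprod :: "('q, 'a) transducer \<Rightarrow> ('r, 'a) transducer \<Rightarrow> ('q \<times> 'r, 'a) transducer" where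
  "tprod S T = \<lparr>states = states S \<times> states T, alphabet = alphabet S,
     next_state = (\<lambda>(q, q') a. (next_state S q a, next_state T q' (out_letter S q a))),
     out_letter = (\<lambda>(q, q') a. out_letter T q' (out_letter S q a))\<rparr>"

lemma edge_tprod:
  assumes "wf_transducer S" "wf_transducer T" "alphabet S = alphabet T"
  shows "edge (tprod S T) (q, q') a b (p, p') \<longleftrightarrow>
    (\<exists>c. edge S q a c p \<and> edge T q' c b p')"
  using assms by (auto simp: edge_def tprod_def wf_transducer_def)

text \<open>Renaming of the states along a map that is injective on them.\<close>

definition relabel :: "('q \<Rightarrow> 'p) \<Rightarrow> ('q, 'a) transducer \<Rightarrow> ('p, 'a) transducer" where
  "relabel f T = \<lparr>states = f ` states T, alphabet = alphabet T,
     next_state = (\<lambda>p a. f (next_state T (inv_into (states T) f p) a)),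
     out_letter = (\<lambda>p a. out_letter T (inv_into (states T) f p) a)\<rparr>"

lemma edge_relabel:
  assumes "wf_transducer T" "inj_on f (states T)" "q \<in> states T" "p \<in> states T"
  shows "edge (relabel f T) (f q) a b (f p) \<longleftrightarrow> edge T q a b p"
  using assms by (auto simp: edge_def relabel_def wf_transducer_def inj_on_eq_iff)

text \<open>To give all powers the same state type, the left-nested tuples that are the states of
  the \<open>k\<close>-th power are written as lists of length \<open>k\<close>; the power is the iterated product
  transported along this bijection. The exponent \<open>0\<close>, the identity transducer, is a
  convention that is not used.\<close>

fun tpower :: "('q, 'a) transducer \<Rightarrow> nat \<Rightarrow> ('q list, 'a) transducer" where
  "tpower T 0 = \<lparr>states = {[]}, alphabet = alphabet T,
     next_state = (\<lambda>_ _. []), out_letter = (\<lambda>_ a. a)\<rparr>"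
| "tpower T (Suc 0) = relabel (\<lambda>q. [q]) T"
| "tpower T (Suc (Suc k)) = relabel (\<lambda>(u, q). u @ [q]) (tprod (tpower T (Suc k)) T)"

definition orbit :: "('q, 'a) transducer \<Rightarrow> 'q \<Rightarrow> 'q set" where
  "orbit T v = {w. (\<lambda>q p. \<exists>a b. edge T q a b p)\<^sup>*\<^sup>* v w}"

text \<open>For a finite state set the supremum in \<open>nat\<close> is the maximum, and it is \<open>0\<close> when there
  are no states.\<close>

definition tnorm :: "('q, 'a) transducer \<Rightarrow> nat" where
  "tnorm T = (SUP v\<in>states T. card (orbit T v))"

end

theory Submission
  imports Defs
begin

text \<open>
  Let a word \<open>u\<close> over the states \<open>Q\<close> act on words over the alphabet \<open>A\<close>, first letter first, by
  \<open>fold (act T) u\<close>. Dually a word \<open>w\<close> over \<open>A\<close> acts on words over \<open>Q\<close> by \<open>fold (act (dual T)) w\<close>.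

  \<^emph>\<open>Finiteness passes to the dual.\<close> To apply \<open>w\<close> to a word \<open>q # u\<close>, run \<open>T\<close> on \<open>w\<close> from the
  state \<open>q\<close>: the state it ends in is the first letter of the result, and the output word acts on \<open>u\<close>
  (\<open>fold_act_dual_Cons\<close>). By induction, the action of \<open>w\<close> is determined by the states
  \<open>run T q (s w)\<close>, where \<open>q \<in> Q\<close> and \<open>s\<close> ranges over the semigroup of \<open>T\<close> together with the
  identity. If that semigroup is finite, there are only finitely many such tables of states, hence
  finitely many actions of words \<open>w\<close> (\<open>finite_word_maps_dual\<close>). As dualizing is an involution,
  the two semigroups are finite together.

  \<^emph>\<open>Finiteness is boundedness of orbits.\<close> In the \<open>k\<close>-th power of \<open>T\<close> the letter \<open>a\<close> sends the
  vertex \<open>u\<close> to \<open>act (dual T) a u\<close>, so the component of \<open>u\<close> is the orbit of \<open>u\<close> under the action of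
  words over \<open>A\<close> (\<open>orbit_tpower\<close>). If the dual semigroup is finite, no orbit is larger than the
  monoid it generates. Conversely, there are only finitely many ways in which a finite set of
  letters can act on at most \<open>n\<close> points, so two words that have the same effect in each of these
  finitely many actions agree on all orbits of size at most \<open>n\<close>
  (\<open>finite_maps_if_bounded_orbits\<close>).
\<close>

section \<open>Maps defined by words of states\<close>

definition word_map :: "('q, 'a) transducer \<Rightarrow> 'q list \<Rightarrow> 'a list \<Rightarrow> 'a list" where
  "word_map T u = restrict (fold (act T) u) (lists (alphabet T))"

definition run :: "('q, 'a) transducer \<Rightarrow> 'q \<Rightarrow> 'a list \<Rightarrow> 'q" where
  "run T q w = fold (\<lambda>a p. next_state T p a) w q"

lemma length_act [simp]: "length (act T q w) = length w"
  by (induction w arbitrary: q) auto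

lemma length_fold_act [simp]: "length (fold (act T) u w) = length w"
  by (induction u arbitrary: w) auto

lemma fold_act_Nil [simp]: "fold (act T) u [] = []"
  by (induction u) auto

lemma act_in_lists:
  assumes "wf_transducer T" "q \<in> states T" "w \<in> lists (alphabet T)"
  shows "act T q w \<in> lists (alphabet T)"
  using assms(3,2) by (induction w arbitrary: q) (use assms(1) in \<open>auto simp: wf_transducer_def\<close>)

lemma fold_act_in_lists:
  assumes "wf_transducer T" "u \<in> lists (states T)" "w \<in> lists (alphabet T)"
  shows "fold (act T) u w \<in> lists (alphabet T)"
  using assms(2,3) by (induction u arbitrary: w) (auto simp: act_in_lists[OF assms(1)])

lemma run_in_states:
  assumes "wf_transducer T" "q \<in> states T" "w \<in> lists (alphabet T)"
  shows "run T q w \<in> states T"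
  using assms(3,2) unfolding run_def
  by (induction w arbitrary: q) (use assms(1) in \<open>auto simp: wf_transducer_def\<close>)

lemma word_map_append:
  assumes "wf_transducer T" "u \<in> lists (states T)"
  shows "word_map T (u @ v) = compose (lists (alphabet T)) (word_map T v) (word_map T u)"
  by (rule ext) (simp add: word_map_def compose_def fold_act_in_lists[OF assms])

lemma word_map_single: "word_map T [q] = state_map T q"
  by (simp add: word_map_def state_map_def)

text \<open>The empty word contributes the identity, which need not lie in the semigroup; finiteness
  is insensitive to this one extra element.\<close>

lemma word_maps_eq_insert_semigroup:
  assumes "wf_transducer T"
  shows "word_map T ` lists (states T) = insert (word_map T []) (transducer_semigroup T)"
proof (intro equalityI subsetI)
  have "word_map T u \<in> transducer_semigroup T" if "u \<in> lists (states T)" "u \<noteq> []" for u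
    using that
  proof (induction u)
    case (Cons q u)
    show ?case
    proof (cases "u = []")
      case True
      with Cons show ?thesis by (simp add: word_map_single transducer_semigroup.generator)
    next
      case False
      then show ?thesis
        using Cons word_map_append[OF assms, of "[q]" u]
        by (simp add: word_map_single transducer_semigroup.generator transducer_semigroup.product)
    qed
  qed simp
  then show "f \<in> insert (word_map T []) (transducer_semigroup T)"
    if "f \<in> word_map T ` lists (states T)" for f
    using that by auto
next
  have "f \<in> word_map T ` lists (states T)" if "f \<in> transducer_semigroup T" for f
    using that
  proof induction
    case (generator q)
    then have "[q] \<in> lists (states T)" by simp
    then show ?case by (metis word_map_single image_eqI)
  next
    case (product f g)
    then obtain u v where "f = word_map T u" "u \<in> lists (states T)"
      "g = word_map T v" "v \<in> lists (states T)"
      by auto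
    then have "compose (lists (alphabet T)) f g = word_map T (v @ u)" "v @ u \<in> lists (states T)"
      by (auto simp: word_map_append[OF assms])
    then show ?case by blast
  qed
  then show "f \<in> word_map T ` lists (states T)"
    if "f \<in> insert (word_map T []) (transducer_semigroup T)" for f
    using that by auto
qed

lemma finite_semigroup_iff:
  assumes "wf_transducer T"
  shows "finite (transducer_semigroup T) \<longleftrightarrow> finite (word_map T ` lists (states T))"
  by (simp add: word_maps_eq_insert_semigroup[OF assms])

lemma finite_image_if_determined:
  assumes "finite (g ` X)" "\<And>x y. x \<in> X \<Longrightarrow> y \<in> X \<Longrightarrow> g x = g y \<Longrightarrow> f x = f y"
  shows "finite (f ` X)"
proof -
  have "f x = (f \<circ> inv_into X g) (g x)" if "x \<in> X" for x
    using that assms(2)[of x "inv_into X g (g x)"] by (simp add: inv_into_into f_inv_into_f)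
  then have "f ` X \<subseteq> (f \<circ> inv_into X g) ` g ` X" by blast
  with assms(1) show ?thesis using finite_surj by blast
qed

section \<open>The dual transducer\<close>

lemma states_dual [simp]: "states (dual T) = alphabet T"
  and alphabet_dual [simp]: "alphabet (dual T) = states T"
  and next_state_dual [simp]: "next_state (dual T) a q = out_letter T q a"
  and out_letter_dual [simp]: "out_letter (dual T) a q = next_state T q a"
  by (simp_all add: dual_def)

lemma dual_dual [simp]: "dual (dual T) = T"
  by (simp add: dual_def)

lemma wf_dual [simp]: "wf_transducer (dual T) \<longleftrightarrow> wf_transducer T"
  by (auto simp: wf_transducer_def)

text \<open>Feeding \<open>w\<close> through \<open>q\<close> first changes \<open>q\<close> into the state reached, and what reaches the
  remaining letters is the output of \<open>q\<close>.\<close>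

lemma fold_act_dual_Cons:
  "fold (act (dual T)) w (q # u) = run T q w # fold (act (dual T)) (act T q w) u"
  by (induction w arbitrary: q u) (auto simp: run_def)

lemma fold_act_dual_cong:
  assumes "u \<in> lists (states T)"
    and "\<And>v q. v \<in> lists (states T) \<Longrightarrow> q \<in> states T \<Longrightarrow>
      run T q (fold (act T) v w) = run T q (fold (act T) v w')"
  shows "fold (act (dual T)) w u = fold (act (dual T)) w' u"
  using assms
proof (induction u arbitrary: w w')
  case Nil
  show ?case by simp
next
  case (Cons q u)
  have "run T p (fold (act T) v (act T q w)) = run T p (fold (act T) v (act T q w'))"
    if "v \<in> lists (states T)" "p \<in> states T" for v p
    using Cons.prems[of "q # v" p] Cons.hyps that by simp
  moreover have "run T q w = run T q w'"
    using Cons.prems[of "[]" q] Cons.hyps by simp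
  ultimately show ?case
    using Cons.IH[of "act T q w" "act T q w'"] by (simp add: fold_act_dual_Cons)
qed

text \<open>A word \<open>w\<close> over the alphabet acts on state words through the table of the states
  \<open>run T q (s w)\<close>; when there are finitely many maps \<open>s\<close>, there are finitely many tables.\<close>

lemma finite_word_maps_dual:
  assumes wf: "wf_transducer T" and fin: "finite (word_map T ` lists (states T))"
  shows "finite (word_map (dual T) ` lists (states (dual T)))"
proof -
  define M where "M = word_map T ` lists (states T)"
  define table where "table w = restrict (\<lambda>(s, q). run T q (s w)) (M \<times> states T)" for w
  have "s w \<in> lists (alphabet T)" if "s \<in> M" "w \<in> lists (alphabet T)" for s w
    using that fold_act_in_lists[OF wf]
    by (auto simp: M_def word_map_def del: in_listsI in_listsD)
  then have "table ` lists (alphabet T) \<subseteq> (M \<times> states T) \<rightarrow>\<^sub>E states T"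
    unfolding table_def using run_in_states[OF wf]
    by (auto del: in_listsI in_listsD split: if_splits)
  moreover have "finite ((M \<times> states T) \<rightarrow>\<^sub>E states T)"
    using wf fin by (intro finite_PiE) (auto simp: M_def wf_transducer_def)
  ultimately have "finite (table ` lists (alphabet T))"
    by (rule finite_subset)
  then have "finite (word_map (dual T) ` lists (alphabet T))"
  proof (rule finite_image_if_determined)
    fix w w' assume w: "w \<in> lists (alphabet T)" and w': "w' \<in> lists (alphabet T)"
      and eq: "table w = table w'"
    have "run T q (fold (act T) v w) = run T q (fold (act T) v w')"
      if "v \<in> lists (states T)" "q \<in> states T" for v q
      using fun_cong[OF eq, of "(word_map T v, q)"] that w w'
      by (simp add: table_def M_def word_map_def)
    then show "word_map (dual T) w = word_map (dual T) w'"
      unfolding word_map_def by (intro restrict_ext fold_act_dual_cong) simp_all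
  qed
  then show ?thesis by simp
qed

lemma finite_semigroup_dual_iff:
  assumes "wf_transducer T"
  shows "finite (transducer_semigroup (dual T)) \<longleftrightarrow> finite (transducer_semigroup T)"
  using finite_word_maps_dual[of T] finite_word_maps_dual[of "dual T"] assms
  by (auto simp: finite_semigroup_iff)

section \<open>Components of the powers as orbits\<close>

lemma act_dual_snoc:
  "act (dual T) a (u @ [q]) = act (dual T) a u @ [next_state T q (fold (out_letter T) u a)]"
  by (induction u arbitrary: a) auto

lemma relabel_inj:
  assumes "inj_on f (states T)" "q \<in> states T"
  shows "next_state (relabel f T) (f q) a = f (next_state T q a)"
    and "out_letter (relabel f T) (f q) a = out_letter T q a"
  using assms by (simp_all add: relabel_def)

text \<open>The output function is carried along because it drives the last factor of the next
  power.\<close>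

lemma tpower_structure:
  "states (tpower T k) = {u \<in> lists (states T). length u = k} \<and> alphabet (tpower T k) = alphabet T \<and>
   (\<forall>u \<in> states (tpower T k). \<forall>a. next_state (tpower T k) u a = act (dual T) a u \<and>
     out_letter (tpower T k) u a = fold (out_letter T) u a)"
proof (induction T k rule: tpower.induct)
  case (1 T)
  show ?case by auto
next
  case (2 T)
  have "inj_on (\<lambda>q. [q]) (states T)" by (simp add: inj_on_def)
  note rel = relabel_inj[OF this]
  have st: "states (tpower T (Suc 0)) = (\<lambda>q. [q]) ` states T"
    by (simp add: relabel_def)
  also have "\<dots> = {u \<in> lists (states T). length u = Suc 0}"
    by (auto simp: length_Suc_conv)
  finally have "states (tpower T (Suc 0)) = {u \<in> lists (states T). length u = Suc 0}" .
  moreover have "next_state (tpower T (Suc 0)) u a = act (dual T) a u \<and>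
      out_letter (tpower T (Suc 0)) u a = fold (out_letter T) u a"
    if "u \<in> states (tpower T (Suc 0))" for u a
    using that rel unfolding st by auto
  moreover have "alphabet (tpower T (Suc 0)) = alphabet T"
    by (simp add: relabel_def)
  ultimately show ?case by blast
next
  case (3 T k)
  let ?P = "tprod (tpower T (Suc k)) T" and ?f = "\<lambda>(u, q). u @ [q]"
  have "inj_on ?f (states ?P)" by (auto simp: inj_on_def)
  note rel = relabel_inj[OF this]
  have st: "states (tpower T (Suc (Suc k))) = ?f ` (states (tpower T (Suc k)) \<times> states T)"
    by (simp add: relabel_def tprod_def)
  have "?f ` ({u \<in> lists (states T). length u = Suc k} \<times> states T)
      = {u \<in> lists (states T). length u = Suc (Suc k)}" (is "?f ` ?L = ?R")
  proof
    show "?R \<subseteq> ?f ` ?L"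
    proof
      fix u assume u: "u \<in> ?R"
      then have "u = ?f (butlast u, last u)" "(butlast u, last u) \<in> ?L"
        by (cases u rule: rev_cases; auto)+
      then show "u \<in> ?f ` ?L" by blast
    qed
  qed auto
  then have states: "states (tpower T (Suc (Suc k))) = ?R"
    using st 3 by simp
  have "next_state (tpower T (Suc (Suc k))) u a = act (dual T) a u \<and>
      out_letter (tpower T (Suc (Suc k))) u a = fold (out_letter T) u a"
    if u: "u \<in> states (tpower T (Suc (Suc k)))" for u a
  proof -
    from u obtain v q where uv: "u = v @ [q]"
      and v: "v \<in> states (tpower T (Suc k))" "q \<in> states T"
      unfolding st by auto
    then have "(v, q) \<in> states ?P" by (simp add: tprod_def)
    from rel[OF this, of a] show ?thesis
      using 3 v by (simp add: uv tprod_def act_dual_snoc)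
  qed
  moreover have "alphabet (tpower T (Suc (Suc k))) = alphabet T"
    using 3 by (simp add: relabel_def tprod_def)
  ultimately show ?case using states by blast
qed

lemma orbit_tpower:
  assumes wf: "wf_transducer T" and u: "u \<in> states (tpower T k)"
  shows "orbit (tpower T k) u = (\<lambda>w. fold (act (dual T)) w u) ` lists (alphabet T)"
proof -
  let ?P = "tpower T k" and ?D = "dual T"
  have st: "states ?P = {u \<in> lists (states T). length u = k}"
    and al: "alphabet ?P = alphabet T"
    and ns: "\<And>u a. u \<in> states ?P \<Longrightarrow> next_state ?P u a = act ?D a u"
    using tpower_structure[of T k] by blast+
  have closed: "fold (act ?D) w u \<in> states ?P" if "w \<in> lists (alphabet T)" for w
    using fold_act_in_lists[of ?D w u] that u wf by (simp add: st)
  have edge_iff: "(\<exists>a b. edge ?P v a b v') \<longleftrightarrow> (\<exists>a\<in>alphabet T. v' = act ?D a v)"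
    if "v \<in> states ?P" for v v'
    using that by (auto simp: edge_def al ns)
  show ?thesis
  proof (intro equalityI subsetI)
    fix v assume "v \<in> orbit ?P u"
    then have "(\<lambda>q p. \<exists>a b. edge ?P q a b p)\<^sup>*\<^sup>* u v" by (simp add: orbit_def)
    then show "v \<in> (\<lambda>w. fold (act ?D) w u) ` lists (alphabet T)"
    proof induction
      case base
      show ?case by (rule image_eqI[of _ _ "[]"]) auto
    next
      case (step v v')
      then obtain w where w: "w \<in> lists (alphabet T)" "v = fold (act ?D) w u" by auto
      with step.hyps(2) edge_iff[OF closed[OF w(1)]]
      obtain a where "a \<in> alphabet T" "v' = act ?D a v" by auto
      with w show ?case by (intro image_eqI[of _ _ "w @ [a]"]) auto
    qed
  next
    fix v assume "v \<in> (\<lambda>w. fold (act ?D) w u) ` lists (alphabet T)"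
    then obtain w where w: "w \<in> lists (alphabet T)" and v: "v = fold (act ?D) w u" by auto
    from w have "(\<lambda>q p. \<exists>a b. edge ?P q a b p)\<^sup>*\<^sup>* u (fold (act ?D) w u)"
    proof (induction w rule: rev_induct)
      case (snoc a w)
      then have "\<exists>c b. edge ?P (fold (act ?D) w u) c b (act ?D a (fold (act ?D) w u))"
        using edge_iff[OF closed] by auto
      with snoc show ?case by (auto intro: rtranclp.rtrancl_into_rtrancl)
    qed simp
    then show "v \<in> orbit ?P u" by (simp add: orbit_def v)
  qed
qed

lemma tnorm_le_iff:
  assumes "finite (states T)"
  shows "tnorm T \<le> n \<longleftrightarrow> (\<forall>v\<in>states T. card (orbit T v) \<le> n)"
proof (cases "states T = {}")
  case False
  with assms show ?thesis by (simp add: tnorm_def cSUP_le_iff)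
qed (simp add: tnorm_def)

lemma bounded_tnorm_iff:
  assumes "wf_transducer T"
  shows "(\<forall>k\<ge>1. tnorm (tpower T k) \<le> n) \<longleftrightarrow>
    (\<forall>u\<in>lists (states T). u \<noteq> [] \<longrightarrow> card ((\<lambda>w. fold (act (dual T)) w u) ` lists (alphabet T)) \<le> n)"
    (is "_ \<longleftrightarrow> ?R")
proof -
  have st: "states (tpower T k) = {u \<in> lists (states T). length u = k}" for k
    using tpower_structure[of T k] by blast
  have "finite (states (tpower T k))" for k
    using finite_lists_length_eq[of "states T" k] assms
    by (simp add: st wf_transducer_def lists_eq_set)
  then have "(\<forall>k\<ge>1. tnorm (tpower T k) \<le> n) \<longleftrightarrow> (\<forall>k\<ge>1. \<forall>u\<in>states (tpower T k).
      card ((\<lambda>w. fold (act (dual T)) w u) ` lists (alphabet T)) \<le> n)"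
    by (simp add: tnorm_le_iff orbit_tpower[OF assms])
  also have "\<dots> \<longleftrightarrow> ?R"
    by (auto simp: st Suc_le_eq)
  finally show ?thesis .
qed

section \<open>Bounded orbits\<close>

text \<open>Any orbit with at most \<open>n\<close> points can be renamed to a subset of \<open>{..<n}\<close>, which turns the
  letters into a map \<open>A \<times> {..<n} \<rightarrow> {..<n}\<close>. There are finitely many such maps, so a word has
  only finitely many possible combined effects on all of them.\<close>

lemma finite_maps_if_bounded_orbits:
  fixes f :: "'a \<Rightarrow> 'x \<Rightarrow> 'x"
  assumes A: "finite A"
    and orb: "\<And>x. x \<in> X \<Longrightarrow> finite ((\<lambda>w. fold f w x) ` lists A) \<and> card ((\<lambda>w. fold f w x) ` lists A) \<le> n"
  shows "finite ((\<lambda>w. restrict (fold f w) X) ` lists A)"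
proof -
  define \<Delta> where "\<Delta> = (A \<times> {..<n}) \<rightarrow>\<^sub>E {..<n}"
  define effect where
    "effect w = restrict (\<lambda>(\<delta>, i). fold (\<lambda>a j. \<delta> (a, j)) w i) (\<Delta> \<times> {..<n})" for w
  have inside: "fold (\<lambda>a j. \<delta> (a, j)) w i < n" if "\<delta> \<in> \<Delta>" "w \<in> lists A" "i < n" for \<delta> w i
    using that(2,3)
  proof (induction w arbitrary: i)
    case (Cons a w)
    then have "\<delta> (a, i) < n" using \<open>\<delta> \<in> \<Delta>\<close> by (auto simp: \<Delta>_def PiE_iff)
    with Cons show ?case by simp
  qed simp
  have "effect ` lists A \<subseteq> (\<Delta> \<times> {..<n}) \<rightarrow>\<^sub>E {..<n}"
    unfolding effect_def using inside
    by (auto del: in_listsI in_listsD split: if_splits)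
  moreover have "finite \<Delta>"
    using A by (auto simp: \<Delta>_def intro: finite_PiE)
  then have "finite ((\<Delta> \<times> {..<n}) \<rightarrow>\<^sub>E {..<n})"
    by (auto intro: finite_PiE)
  ultimately have "finite (effect ` lists A)"
    by (rule finite_subset)
  then show ?thesis
  proof (rule finite_image_if_determined)
    fix w w' assume w: "w \<in> lists A" and w': "w' \<in> lists A" and eq: "effect w = effect w'"
    have "fold f w x = fold f w' x" if x: "x \<in> X" for x
    proof -
      define Orb where "Orb = (\<lambda>w. fold f w x) ` lists A"
      have "finite Orb" "card Orb \<le> card {..<n}" using orb[OF x] by (auto simp: Orb_def)
      then obtain h where h: "h ` Orb \<subseteq> {..<n}" "inj_on h Orb"
        using card_le_inj[of Orb "{..<n}"] by auto
      have x_Orb: "x \<in> Orb" unfolding Orb_def by (rule image_eqI[of _ _ "[]"]) auto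
      have Orb_step: "f a y \<in> Orb" if "y \<in> Orb" "a \<in> A" for a y
      proof -
        from that(1) obtain v where "v \<in> lists A" "y = fold f v x" by (auto simp: Orb_def)
        then have "f a y = fold f (v @ [a]) x" "v @ [a] \<in> lists A" using that(2) by auto
        then show ?thesis unfolding Orb_def by blast
      qed
      \<comment> \<open>the action on the orbit after renaming; numbers that name no point are sent to \<open>h x\<close>,
        only to make the map total\<close>
      define \<delta> where "\<delta> = restrict (\<lambda>(a, i). if i \<in> h ` Orb then h (f a (inv_into Orb h i)) else h x)
        (A \<times> {..<n})"
      have \<delta>: "\<delta> \<in> \<Delta>"
        unfolding \<delta>_def \<Delta>_def using h x_Orb Orb_step by (auto simp: image_subset_iff)
      have sim: "fold (\<lambda>a j. \<delta> (a, j)) v (h y) = h (fold f v y) \<and> fold f v y \<in> Orb"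
        if "v \<in> lists A" "y \<in> Orb" for v y
        using that
      proof (induction v arbitrary: y)
        case (Cons a v)
        then have "\<delta> (a, h y) = h (f a y)" using h by (auto simp: \<delta>_def image_subset_iff)
        with Cons Orb_step show ?case by simp
      qed simp
      have "(\<delta>, h x) \<in> \<Delta> \<times> {..<n}" using \<delta> h(1) x_Orb by auto
      with fun_cong[OF eq, of "(\<delta>, h x)"]
      have "fold (\<lambda>a j. \<delta> (a, j)) w (h x) = fold (\<lambda>a j. \<delta> (a, j)) w' (h x)"
        by (simp add: effect_def)
      then show ?thesis using sim[OF w x_Orb] sim[OF w' x_Orb] h(2) by (auto dest: inj_onD)
    qed
    then show "restrict (fold f w) X = restrict (fold f w') X" by (intro restrict_ext) auto
  qed
qed

lemma finite_semigroup_dual_iff_bounded_tnorm: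
  assumes wf: "wf_transducer T"
  shows "finite (transducer_semigroup (dual T)) \<longleftrightarrow> (\<exists>n. \<forall>k\<ge>1. tnorm (tpower T k) \<le> n)"
proof -
  let ?D = "dual T"
  let ?orb = "\<lambda>u. (\<lambda>w. fold (act ?D) w u) ` lists (alphabet T)"
  have "finite (word_map ?D ` lists (alphabet T)) \<longleftrightarrow>
    (\<exists>n. \<forall>u\<in>lists (states T). u \<noteq> [] \<longrightarrow> card (?orb u) \<le> n)" (is "finite ?M \<longleftrightarrow> _")
  proof
    assume fin: "finite ?M"
    have "card (?orb u) \<le> card ?M" if "u \<in> lists (states T)" for u
    proof -
      have "?orb u = (\<lambda>g. g u) ` ?M"
        using that by (simp add: image_image word_map_def)
      then show ?thesis using card_image_le[OF fin] by simp
    qed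
    then show "\<exists>n. \<forall>u\<in>lists (states T). u \<noteq> [] \<longrightarrow> card (?orb u) \<le> n" by blast
  next
    assume "\<exists>n. \<forall>u\<in>lists (states T). u \<noteq> [] \<longrightarrow> card (?orb u) \<le> n"
    then obtain n where n: "\<And>u. u \<in> lists (states T) \<Longrightarrow> u \<noteq> [] \<Longrightarrow> card (?orb u) \<le> n" by blast
    have fin: "finite (?orb u)" if "u \<in> lists (states T)" for u
    proof (rule finite_subset)
      show "?orb u \<subseteq> {v. set v \<subseteq> states T \<and> length v = length u}"
        using fold_act_in_lists[of ?D _ u] wf that by (fastforce simp: in_lists_conv_set)
      show "finite {v. set v \<subseteq> states T \<and> length v = length u}"
        using wf by (intro finite_lists_length_eq) (simp add: wf_transducer_def)
    qed
    \<comment> \<open>powers with positive exponent do not see the empty word, whose orbit is a single point\<close>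
    have "?orb [] \<subseteq> {[]}" by auto
    from card_mono[OF _ this] have "card (?orb []) \<le> 1" by simp
    then have card: "card (?orb u) \<le> max n 1" if "u \<in> lists (states T)" for u
      using n[OF that] by (cases "u = []") auto
    have "finite ((\<lambda>w. restrict (fold (act ?D) w) (lists (states T))) ` lists (alphabet T))"
    proof (rule finite_maps_if_bounded_orbits)
      show "finite (alphabet T)" using wf by (simp add: wf_transducer_def)
      show "finite (?orb u) \<and> card (?orb u) \<le> max n 1" if "u \<in> lists (states T)" for u
        using fin[OF that] card[OF that] by (rule conjI)
    qed
    then show "finite ?M" by (simp add: word_map_def [abs_def])
  qed
  then show ?thesis
    using wf by (simp add: finite_semigroup_iff bounded_tnorm_iff del: One_nat_def)
qed

section \<open>The equivalence\<close>

theorem proposition6: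
  fixes T :: "('q, 'a) transducer"
  assumes "wf_transducer T"
  shows "(finite (transducer_semigroup T) \<longleftrightarrow> (\<exists>n. \<forall>k\<ge>1. tnorm (tpower (dual T) k) \<le> n))
    \<and> ((\<exists>n. \<forall>k\<ge>1. tnorm (tpower (dual T) k) \<le> n) \<longleftrightarrow> finite (transducer_semigroup (dual T)))
    \<and> (finite (transducer_semigroup (dual T)) \<longleftrightarrow> (\<exists>m. \<forall>k\<ge>1. tnorm (tpower T k) \<le> m))"
  using finite_semigroup_dual_iff_bounded_tnorm[of T]
    finite_semigroup_dual_iff_bounded_tnorm[of "dual T"]
    finite_semigroup_dual_iff[of T] assms
  by simp

end
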